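(* Let $F$ be a field. The full heptagon holds for colorings by 3-cocycles modulo $\omega$. That is: for every $F$-valued simplicial 3-cocycle $\omega$ on a 6-simplex $\Delta^6$ with $\omega_{ijkl}\neq0$ for all tetrahedra $ijkl$, and for every partition of the seven 5-faces of $\Delta^6$ into two nonempty sets, generating subcomplexes $C_{\mathrm{ini}}$ and $C_{\mathrm{fin}}$ (the initial and final clusters of a 5-dimensional Pachner move, with common boundary $\partial C_{\mathrm{ini}}=\partial C_{\mathrm{fin}}$), the set of permitted colorings of $\partial C_{\mathrm{ini}}$ obtained by restriction from permitted colorings of $C_{\mathrm{ini}}$ coincides with the set of permitted colorings of $\partial C_{\mathrm{fin}}$ obtained by restriction from permitted colorings of $C_{\mathrm{fin}}$.
   Context: Colorings. Let $\omega$ be a simplicial 3-cocycle with values in $F$ on $\Delta^6$, with $\omega_{ijkl}\ne0$ for all tetrahedra. The set of colors of a 4-simplex $\Delta^4\subset\Delta^6$ is the 3-dimensional $F$-linear space $V_{\Delta^4}$ of $F$-valued simplicial 3-cocycles on $\Delta^4$ modulo multiples of $\omega|_{\Delta^4}$. A permitted coloring of a 5-simplex $\Delta^5$ is an assignment of colors to its six 4-faces for which there is a 3-cocycle $\nu$ on $\Delta^5$ such that the color of each 4-face $\Delta^4$ is the class of $\nu|_{\Delta^4}$. A permitted coloring of a complex $C$ made of 5-simplices is an assignment of a color to every 4-simplex of $C$ whose restriction to each 5-simplex of $C$ is permitted (different 5-simplices may have different $\nu$). A permitted coloring of $\partial C$ is the restriction to the 4-simplices of $\partial C$ of a permitted coloring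 of $C$. *)

theory Defs
  imports Main "HOL-Library.FuncSet"
begin

text \<open>A simplex is the finite set of its vertices, and a simplicial complex all of whose maximal
  simplices are 5-simplices is given by the set of these 5-simplices.\<close>

definition faces :: "nat \<Rightarrow> 'v set \<Rightarrow> 'v set set" where
  "faces n S = {\<sigma>. \<sigma> \<subseteq> S \<and> card \<sigma> = n + 1}"

text \<open>An \<open>n\<close>-cochain takes its values on the faces with their vertices in increasing order, so that
  \<open>\<omega> {i, j, k, l}\<close> is \<open>\<omega>\<^sub>i\<^sub>j\<^sub>k\<^sub>l\<close> for \<open>i < j < k < l\<close>.
  It is undefined outside \<open>faces n S\<close>.\<close>

definition cochains :: "nat \<Rightarrow> 'v set \<Rightarrow> ('v set \<Rightarrow> 'a) set" where
  "cochains n S = faces n S \<rightarrow>\<^sub>E UNIV"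

definition coboundary :: "('v::linorder set \<Rightarrow> 'a::field) \<Rightarrow> 'v set \<Rightarrow> 'a" where
  "coboundary f \<rho> = (\<Sum>v\<in>\<rho>. (- 1) ^ card {u \<in> \<rho>. u < v} * f (\<rho> - {v}))"

definition cocycles :: "nat \<Rightarrow> 'v::linorder set \<Rightarrow> ('v set \<Rightarrow> 'a::field) set" where
  "cocycles n S = {f \<in> cochains n S. \<forall>\<rho>\<in>faces (n + 1) S. coboundary f \<rho> = 0}"

definition color_rel ::
  "('v::linorder set \<Rightarrow> 'a::field) \<Rightarrow> 'v set \<Rightarrow> (('v set \<Rightarrow> 'a) \<times> ('v set \<Rightarrow> 'a)) set" where
  "color_rel \<omega> T = {(\<mu>, \<nu>). \<mu> \<in> cocycles 3 T \<and> \<nu> \<in> cocycles 3 T \<and>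
     (\<exists>c. \<forall>\<sigma>\<in>faces 3 T. \<mu> \<sigma> - \<nu> \<sigma> = c * \<omega> \<sigma>)}"

definition colors :: "('v::linorder set \<Rightarrow> 'a::field) \<Rightarrow> 'v set \<Rightarrow> ('v set \<Rightarrow> 'a) set set" where
  "colors \<omega> T = cocycles 3 T // color_rel \<omega> T"

definition color_of ::
  "('v::linorder set \<Rightarrow> 'a::field) \<Rightarrow> 'v set \<Rightarrow> ('v set \<Rightarrow> 'a) \<Rightarrow> ('v set \<Rightarrow> 'a) set" where
  "color_of \<omega> T \<nu> = color_rel \<omega> T `` {restrict \<nu> (faces 3 T)}"

definition permitted_simplex ::
  "('v::linorder set \<Rightarrow> 'a::field) \<Rightarrow> 'v set \<Rightarrow> ('v set \<Rightarrow> ('v set \<Rightarrow> 'a) set) set" where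
  "permitted_simplex \<omega> S = {x \<in> Pi\<^sub>E (faces 4 S) (colors \<omega>).
     \<exists>\<nu>\<in>cocycles 3 S. \<forall>T\<in>faces 4 S. x T = color_of \<omega> T \<nu>}"

definition permitted ::
  "('v::linorder set \<Rightarrow> 'a::field) \<Rightarrow> 'v set set \<Rightarrow> ('v set \<Rightarrow> ('v set \<Rightarrow> 'a) set) set" where
  "permitted \<omega> C = {x \<in> Pi\<^sub>E (\<Union>S\<in>C. faces 4 S) (colors \<omega>).
     \<forall>S\<in>C. restrict x (faces 4 S) \<in> permitted_simplex \<omega> S}"

definition boundary :: "'v set set \<Rightarrow> 'v set set" where
  "boundary C = {T. \<exists>!S. S \<in> C \<and> T \<in> faces 4 S}"

definition permitted_boundary ::
  "('v::linorder set \<Rightarrow> 'a::field) \<Rightarrow> 'v set set \<Rightarrow> ('v set \<Rightarrow> ('v set \<Rightarrow> 'a) set) set" where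
  "permitted_boundary \<omega> C = (\<lambda>x. restrict x (boundary C)) ` permitted \<omega> C"

lemma equiv_color_rel: "equiv (cocycles 3 T) (color_rel \<omega> T)"
proof (rule equivI)
  show "color_rel \<omega> T \<subseteq> cocycles 3 T \<times> cocycles 3 T"
    by (auto simp: color_rel_def)
  show "refl_on (cocycles 3 T) (color_rel \<omega> T)"
    by (auto simp: refl_on_def color_rel_def intro!: exI[of _ 0])
  show "sym (color_rel \<omega> T)"
  proof (rule symI)
    fix \<mu> \<nu> assume "(\<mu>, \<nu>) \<in> color_rel \<omega> T"
    then obtain c where *: "\<mu> \<in> cocycles 3 T" "\<nu> \<in> cocycles 3 T"
      "\<And>\<sigma>. \<sigma> \<in> faces 3 T \<Longrightarrow> \<mu> \<sigma> - \<nu> \<sigma> = c * \<omega> \<sigma>"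
      by (auto simp: color_rel_def)
    have "\<nu> \<sigma> - \<mu> \<sigma> = (- c) * \<omega> \<sigma>" if "\<sigma> \<in> faces 3 T" for \<sigma>
      using *(3)[OF that] by (metis minus_diff_eq mult_minus_left)
    with * show "(\<nu>, \<mu>) \<in> color_rel \<omega> T" unfolding color_rel_def by blast
  qed
  show "trans (color_rel \<omega> T)"
  proof (rule transI)
    fix \<mu> \<nu> \<pi> assume "(\<mu>, \<nu>) \<in> color_rel \<omega> T" "(\<nu>, \<pi>) \<in> color_rel \<omega> T"
    then obtain c d where *: "\<mu> \<in> cocycles 3 T" "\<pi> \<in> cocycles 3 T"
      "\<And>\<sigma>. \<sigma> \<in> faces 3 T \<Longrightarrow> \<mu> \<sigma> - \<nu> \<sigma> = c * \<omega> \<sigma>"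
      "\<And>\<sigma>. \<sigma> \<in> faces 3 T \<Longrightarrow> \<nu> \<sigma> - \<pi> \<sigma> = d * \<omega> \<sigma>"
      by (auto simp: color_rel_def)
    have "\<mu> \<sigma> - \<pi> \<sigma> = (c + d) * \<omega> \<sigma>" if "\<sigma> \<in> faces 3 T" for \<sigma>
      using *(3,4)[OF that] by (simp add: algebra_simps)
    with * show "(\<mu>, \<pi>) \<in> color_rel \<omega> T" unfolding color_rel_def by blast
  qed
qed

lemma restrict_cocycle:
  assumes "\<nu> \<in> cocycles n S" "T \<subseteq> S"
  shows "restrict \<nu> (faces n T) \<in> cocycles n T"
proof -
  have "coboundary (restrict \<nu> (faces n T)) \<rho> = 0" if \<rho>: "\<rho> \<in> faces (n + 1) T" for \<rho>
  proof -
    have "finite \<rho>" using \<rho> by (intro card_ge_0_finite) (simp add: faces_def)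
    then have "\<rho> - {v} \<in> faces n T" if "v \<in> \<rho>" for v
      using \<rho> that by (auto simp: faces_def)
    then have "coboundary (restrict \<nu> (faces n T)) \<rho> = coboundary \<nu> \<rho>"
      unfolding coboundary_def by (intro sum.cong) auto
    also have "\<dots> = 0" using assms \<rho> by (auto simp: cocycles_def faces_def)
    finally show ?thesis .
  qed
  then show ?thesis by (simp add: cocycles_def cochains_def)
qed

lemma color_of_in_colors:
  assumes "\<nu> \<in> cocycles 3 S" "T \<subseteq> S"
  shows "color_of \<omega> T \<nu> \<in> colors \<omega> T"
  unfolding color_of_def colors_def by (rule quotientI) (rule restrict_cocycle[OF assms])

lemma two_five_faces:
  fixes V :: "'v set"
  assumes "card V = 7" "T \<in> faces 4 V"
  obtains P Q where "P \<noteq> Q" "{S \<in> faces 5 V. T \<in> faces 4 S} = {P, Q}"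
proof -
  have fin: "finite V" using assms(1) by (simp add: card_ge_0_finite)
  have T: "T \<subseteq> V" "card T = 5"
    using assms(2) by (auto simp: faces_def)
  then have finT: "finite T" using fin finite_subset by blast
  have "card (V - T) = 2" using T finT assms(1) by (simp add: card_Diff_subset)
  then obtain a b where ab: "V - T = {a, b}" "a \<noteq> b" unfolding card_2_iff by blast
  then have abV: "a \<in> V" "a \<notin> T" "b \<in> V" "b \<notin> T" by blast+
  have "{S \<in> faces 5 V. T \<in> faces 4 S} = {insert a T, insert b T}" (is "?L = ?R")
  proof
    show "?R \<subseteq> ?L" using abV T finT by (simp add: faces_def subset_insertI)
    show "?L \<subseteq> ?R"
    proof
      fix S assume "S \<in> ?L"
      then have S: "S \<subseteq> V" "card S = 6" "T \<subseteq> S" by (auto simp: faces_def)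
      have "card (S - T) = 1" using S T finT by (simp add: card_Diff_subset)
      then obtain v where v: "S - T = {v}" by (rule card_1_singletonE)
      then have "v \<in> V - T" using S by blast
      moreover have "S = insert v T" using v S by blast
      ultimately show "S \<in> ?R" unfolding ab(1) by blast
    qed
  qed
  moreover have "insert a T \<noteq> insert b T" using ab(2) abV by blast
  ultimately show ?thesis by (rule that[rotated])
qed

lemma boundary_subset:
  fixes V :: "'v set"
  assumes "card V = 7" "A \<union> B = faces 5 V" "A \<inter> B = {}"
  shows "boundary A \<subseteq> boundary B"
proof
  fix T assume "T \<in> boundary A"
  then obtain S where S: "S \<in> A" "T \<in> faces 4 S"
    and uniq: "\<forall>S'. S' \<in> A \<and> T \<in> faces 4 S' \<longrightarrow> S' = S"
    unfolding boundary_def by (auto elim!: ex1E)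
  have SV: "S \<in> faces 5 V" using S(1) assms(2) by blast
  then have "T \<in> faces 4 V" using S(2) by (auto simp: faces_def)
  then obtain P Q where PQ: "P \<noteq> Q" "{S \<in> faces 5 V. T \<in> faces 4 S} = {P, Q}"
    by (rule two_five_faces[OF assms(1)])
  have "S \<in> {P, Q}" unfolding PQ(2)[symmetric] using S(2) SV by simp
  then obtain R where R: "R \<noteq> S" "{P, Q} = {S, R}"
    using PQ(1) by (metis insert_commute insertE singletonD)
  have "R \<in> {S \<in> faces 5 V. T \<in> faces 4 S}" unfolding PQ(2) R(2) by simp
  then have RV: "R \<in> faces 5 V" "T \<in> faces 4 R" by simp_all
  have "R \<in> B"
  proof (rule ccontr)
    assume "R \<notin> B"
    then have "R \<in> A" using RV(1) assms(2) by blast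
    then show False using uniq RV(2) R(1) by simp
  qed
  moreover have "S' = R" if S': "S' \<in> B" "T \<in> faces 4 S'" for S'
  proof -
    have "S' \<in> faces 5 V" using S'(1) assms(2) by blast
    then have "S' \<in> {S, R}" unfolding R(2)[symmetric] PQ(2)[symmetric] using S'(2) by simp
    moreover have "S' \<noteq> S" using S'(1) S(1) assms(3) by blast
    ultimately show ?thesis by simp
  qed
  ultimately have "\<exists>!S. S \<in> B \<and> T \<in> faces 4 S" using RV(2) by metis
  then show "T \<in> boundary B" by (simp add: boundary_def)
qed

lemma common_boundary:
  fixes V :: "'v set"
  assumes "card V = 7" "A \<union> B = faces 5 V" "A \<inter> B = {}"
  shows "boundary A = boundary B"
proof
  show "boundary A \<subseteq> boundary B" by (rule boundary_subset[OF assms])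
  show "boundary B \<subseteq> boundary A"
    using boundary_subset[of V B A] assms by (metis Int_commute Un_commute)
qed

end

theory Submission
  imports Defs
begin

text \<open>Let \<open>\<nu>\<^sub>S\<close> be cocycles inducing a permitted coloring of one cluster. On a common 4-face of \<open>S\<close> and
  \<open>S'\<close> they differ by a multiple \<open>c\<^sub>S\<^sub>S\<^sub>'\<close> of \<open>\<omega>\<close>. Any three 5-faces of the 6-simplex share a
  tetrahedron, where \<open>\<omega>\<close> does not vanish, so \<open>c\<close> is additive, and subtracting multiples of \<open>\<omega>\<close>
  makes the \<open>\<nu>\<^sub>S\<close> agree on intersections. The vertex opposite to a 5-face of the other cluster lies
  in every \<open>S\<close>, so the cluster is a cone and the glued cocycle is a coboundary on it. Hence it
  extends to the whole 6-simplex and colors the other cluster as well.\<close>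

section \<open>Faces, coboundaries and cocycles\<close>

lemma faces_finite: "\<rho> \<in> faces n S \<Longrightarrow> finite \<rho>"
  by (auto simp: faces_def intro: card_ge_0_finite)

lemma faces_mono: "T \<subseteq> S \<Longrightarrow> faces n T \<subseteq> faces n S"
  by (auto simp: faces_def)

lemma face_remove: "\<rho> \<in> faces (n + 1) S \<Longrightarrow> v \<in> \<rho> \<Longrightarrow> \<rho> - {v} \<in> faces n S"
  using faces_finite[of \<rho> "n + 1" S] by (auto simp: faces_def)

lemma face_insert: "\<sigma> \<in> faces n S \<Longrightarrow> p \<in> S \<Longrightarrow> p \<notin> \<sigma> \<Longrightarrow> insert p \<sigma> \<in> faces (n + 1) S"
  using faces_finite[of \<sigma> n S] by (auto simp: faces_def)

lemma coboundary_cong: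
  assumes "\<rho> \<in> faces (n + 1) S" "\<And>\<sigma>. \<sigma> \<in> faces n S \<Longrightarrow> f \<sigma> = g \<sigma>"
  shows "coboundary f \<rho> = coboundary g \<rho>"
  unfolding coboundary_def by (intro sum.cong refl) (simp only: assms(2) face_remove[OF assms(1)])

lemma coboundary_diff_scale:
  "coboundary (\<lambda>\<sigma>. f \<sigma> - c * g \<sigma>) \<rho> = coboundary f \<rho> - c * coboundary g \<rho>"
  unfolding coboundary_def
  by (simp add: right_diff_distrib sum_subtractf sum_distrib_left mult.left_commute)

text \<open>Each pair \<open>v < w\<close> is removed in both orders. Removing \<open>v\<close>
  first lowers the position of \<open>w\<close> by one, while removing \<open>w\<close> leaves that
  of \<open>v\<close> unchanged, so the two terms cancel.\<close>

lemma coboundary_coboundary: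
  fixes f :: "'v::linorder set \<Rightarrow> 'a::field"
  assumes "finite \<rho>"
  shows "coboundary (coboundary f) \<rho> = 0"
proof -
  define sg :: "'v set \<Rightarrow> 'v \<Rightarrow> 'a" where "sg R v = (- 1) ^ card {u \<in> R. u < v}" for R v
  define h where "h v w = sg \<rho> v * (sg (\<rho> - {v}) w * f (\<rho> - {v} - {w}))" for v w
  have swap: "h w v = - h v w" if "v \<in> \<rho>" "w \<in> \<rho>" "v < w" for v w
  proof -
    have "{u \<in> \<rho> - {w}. u < v} = {u \<in> \<rho>. u < v}" using that by auto
    then have 1: "sg (\<rho> - {w}) v = sg \<rho> v" by (simp add: sg_def)
    have "{u \<in> \<rho>. u < w} = insert v {u \<in> \<rho> - {v}. u < w}" using that by auto
    then have "card {u \<in> \<rho>. u < w} = card (insert v {u \<in> \<rho> - {v}. u < w})" by (rule arg_cong)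
    also have "\<dots> = Suc (card {u \<in> \<rho> - {v}. u < w})"
      using assms by (intro card_insert_disjoint) auto
    finally have "card {u \<in> \<rho>. u < w} = Suc (card {u \<in> \<rho> - {v}. u < w})" .
    then have 2: "sg \<rho> w = - sg (\<rho> - {v}) w" by (simp add: sg_def)
    have 3: "\<rho> - {w} - {v} = \<rho> - {v} - {w}" by blast
    show ?thesis by (simp add: h_def 1 2 3 mult.left_commute)
  qed
  have "coboundary (coboundary f) \<rho> = (\<Sum>v\<in>\<rho>. \<Sum>w\<in>\<rho> - {v}. h v w)"
    by (simp add: coboundary_def h_def sg_def sum_distrib_left)
  also have "\<dots> = (\<Sum>v\<in>\<rho>. (\<Sum>w\<in>{w\<in>\<rho>. v < w}. h v w) + (\<Sum>w\<in>{w\<in>\<rho>. w < v}. h v w))"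
  proof (rule sum.cong[OF refl])
    fix v assume "v \<in> \<rho>"
    have split: "\<rho> - {v} = {w\<in>\<rho>. v < w} \<union> {w\<in>\<rho>. w < v}" by auto
    show "(\<Sum>w\<in>\<rho> - {v}. h v w) = (\<Sum>w\<in>{w\<in>\<rho>. v < w}. h v w) + (\<Sum>w\<in>{w\<in>\<rho>. w < v}. h v w)"
      unfolding split using assms by (intro sum.union_disjoint) auto
  qed
  \<comment> \<open>The bound names of the second sum are exchanged here, so that swapping its
    summation order makes both sums run over the same pairs \<open>v < w\<close>.\<close>
  also have "\<dots> = (\<Sum>v\<in>\<rho>. \<Sum>w\<in>{w\<in>\<rho>. v < w}. h v w) + (\<Sum>w\<in>\<rho>. \<Sum>v\<in>{v\<in>\<rho>. v < w}. h w v)"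
    by (rule sum.distrib)
  also have "(\<Sum>w\<in>\<rho>. \<Sum>v\<in>{v\<in>\<rho>. v < w}. h w v) = (\<Sum>v\<in>\<rho>. \<Sum>w\<in>{w\<in>\<rho>. v < w}. h w v)"
    by (rule sum.swap_restrict[OF assms assms])
  also have "\<dots> = - (\<Sum>v\<in>\<rho>. \<Sum>w\<in>{w\<in>\<rho>. v < w}. h v w)"
    unfolding sum_negf[symmetric] by (intro sum.cong refl) (simp add: swap)
  finally show ?thesis by simp
qed

lemma cocycle_diff_scale:
  assumes "\<nu> \<in> cocycles n S" "\<omega> \<in> cocycles n V" "S \<subseteq> V"
  shows "restrict (\<lambda>\<sigma>. \<nu> \<sigma> - c * \<omega> \<sigma>) (faces n S) \<in> cocycles n S"
proof -
  have "coboundary (restrict (\<lambda>\<sigma>. \<nu> \<sigma> - c * \<omega> \<sigma>) (faces n S)) \<rho> = 0"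
    if "\<rho> \<in> faces (n + 1) S" for \<rho>
  proof -
    have "coboundary (restrict (\<lambda>\<sigma>. \<nu> \<sigma> - c * \<omega> \<sigma>) (faces n S)) \<rho> =
        coboundary (\<lambda>\<sigma>. \<nu> \<sigma> - c * \<omega> \<sigma>) \<rho>"
      using that by (rule coboundary_cong) simp
    also have "\<dots> = 0"
      using assms(1,2) that subsetD[OF faces_mono[OF assms(3)] that]
      by (simp add: coboundary_diff_scale cocycles_def)
    finally show ?thesis .
  qed
  then show ?thesis by (simp add: cocycles_def cochains_def)
qed

section \<open>Cocycles on cones and their extension\<close>

text \<open>If \<open>p\<close> is not in \<open>\<sigma>\<close>, the cocycle equation on
  \<open>insert p \<sigma>\<close> determines the value at \<open>\<sigma>\<close> from values on
  faces through \<open>p\<close>.\<close>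

lemma cocycles_eq_on_cone:
  assumes "\<mu> \<in> cocycles n S" "\<nu> \<in> cocycles n S" "p \<in> S"
    and eq: "\<And>\<sigma>. \<sigma> \<in> faces n S \<Longrightarrow> p \<in> \<sigma> \<Longrightarrow> \<mu> \<sigma> = \<nu> \<sigma>"
    and \<sigma>: "\<sigma> \<in> faces n S"
  shows "\<mu> \<sigma> = \<nu> \<sigma>"
proof (cases "p \<in> \<sigma>")
  case True
  then show ?thesis by (rule eq[OF \<sigma>])
next
  case False
  let ?\<rho> = "insert p \<sigma>"
  let ?s = "(- 1) ^ card {u \<in> ?\<rho>. u < p} :: 'b"
  have \<rho>: "?\<rho> \<in> faces (n + 1) S" by (rule face_insert[OF \<sigma> assms(3) False])
  have fin: "finite \<sigma>" using \<sigma> by (rule faces_finite)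
  have "coboundary \<mu> ?\<rho> - coboundary \<nu> ?\<rho>
      = (\<Sum>v\<in>?\<rho>. (- 1) ^ card {u \<in> ?\<rho>. u < v} * (\<mu> (?\<rho> - {v}) - \<nu> (?\<rho> - {v})))"
    by (simp add: coboundary_def right_diff_distrib sum_subtractf del: sum.insert)
  \<comment> \<open>Every face of \<open>?\<rho>\<close> except the one opposite \<open>p\<close>
    contains \<open>p\<close>, so its term vanishes by \<open>eq\<close>.\<close>
  also have "\<dots> = (\<Sum>v\<in>{p}. (- 1) ^ card {u \<in> ?\<rho>. u < v} * (\<mu> (?\<rho> - {v}) - \<nu> (?\<rho> - {v})))"
  proof (rule sum.mono_neutral_right)
    show "\<forall>v\<in>?\<rho> - {p}. (- 1) ^ card {u \<in> ?\<rho>. u < v} * (\<mu> (?\<rho> - {v}) - \<nu> (?\<rho> - {v})) = 0"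
      using eq[OF face_remove[OF \<rho>]] by auto
  qed (use fin in auto)
  also have "\<dots> = ?s * (\<mu> \<sigma> - \<nu> \<sigma>)" using False by simp
  finally have "?s * (\<mu> \<sigma> - \<nu> \<sigma>) = 0"
    using assms(1,2) \<rho> by (simp add: cocycles_def)
  then show ?thesis by simp
qed

text \<open>All simplices of \<open>C\<close> share the apex \<open>p\<close>, so the glued cochain
  has a primitive on them. The coboundary of this primitive makes sense on all of \<open>V\<close>
  and is a cocycle there.\<close>

lemma cocycle_extension_from_cone:
  fixes N :: "'v::linorder set \<Rightarrow> 'v set \<Rightarrow> 'a::field"
  assumes C: "\<And>S. S \<in> C \<Longrightarrow> S \<subseteq> V \<and> p \<in> S"
    and N: "\<And>S. S \<in> C \<Longrightarrow> N S \<in> cocycles n S"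
    and agree: "\<And>S S' \<sigma>. S \<in> C \<Longrightarrow> S' \<in> C \<Longrightarrow> \<sigma> \<in> faces n (S \<inter> S') \<Longrightarrow> N S \<sigma> = N S' \<sigma>"
  obtains \<nu> where "\<nu> \<in> cocycles n V" "\<And>S \<sigma>. S \<in> C \<Longrightarrow> \<sigma> \<in> faces n S \<Longrightarrow> \<nu> \<sigma> = N S \<sigma>"
proof -
  \<comment> \<open>By \<open>agree\<close> the choice of \<open>S\<close> is immaterial. Outside
    \<open>C\<close> the value is unspecified, which is harmless: \<open>\<nu>\<close> below is a
    coboundary whatever \<open>g\<close> is.\<close>
  define g where "g \<sigma> = N (SOME S. S \<in> C \<and> \<sigma> \<in> faces n S) \<sigma>" for \<sigma>
  have g: "g \<sigma> = N S \<sigma>" if "S \<in> C" "\<sigma> \<in> faces n S" for S \<sigma>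
  proof -
    have "(SOME S. S \<in> C \<and> \<sigma> \<in> faces n S) \<in> C \<and> \<sigma> \<in> faces n (SOME S. S \<in> C \<and> \<sigma> \<in> faces n S)"
      using that by (intro someI[of "\<lambda>S. S \<in> C \<and> \<sigma> \<in> faces n S"]) simp
    then show ?thesis
      unfolding g_def using that by (intro agree) (auto simp: faces_def)
  qed
  \<comment> \<open>the cone operator: a primitive of \<open>g\<close> on the simplices through \<open>p\<close>\<close>
  define \<mu> where "\<mu> \<tau> = (if p \<in> \<tau> then 0 else (- 1) ^ card {u \<in> \<tau>. u < p} * g (insert p \<tau>))" for \<tau>
  define \<nu> where "\<nu> = restrict (coboundary \<mu>) (faces n V)"
  have "coboundary \<nu> \<rho> = 0" if \<rho>: "\<rho> \<in> faces (n + 1) V" for \<rho>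
  proof -
    have "coboundary \<nu> \<rho> = coboundary (coboundary \<mu>) \<rho>"
      using \<rho> by (rule coboundary_cong) (simp add: \<nu>_def)
    then show ?thesis using faces_finite[OF \<rho>] by (simp add: coboundary_coboundary)
  qed
  then have \<nu>: "\<nu> \<in> cocycles n V" by (simp add: \<nu>_def cocycles_def cochains_def)
  have \<nu>_cone: "\<nu> \<sigma> = g \<sigma>" if \<sigma>: "\<sigma> \<in> faces n V" "p \<in> \<sigma>" for \<sigma>
  proof -
    \<comment> \<open>Faces \<open>\<sigma> - {v}\<close> with \<open>v \<noteq> p\<close> still
      contain \<open>p\<close>, where \<open>\<mu>\<close> vanishes.\<close>
    have "coboundary \<mu> \<sigma> = (\<Sum>v\<in>{p}. (- 1) ^ card {u \<in> \<sigma>. u < v} * \<mu> (\<sigma> - {v}))"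
      unfolding coboundary_def
      using \<sigma>(2) faces_finite[OF \<sigma>(1)] by (intro sum.mono_neutral_right) (auto simp: \<mu>_def)
    also have "\<dots> = (- 1) ^ card {u \<in> \<sigma>. u < p} * ((- 1) ^ card {u \<in> \<sigma> - {p}. u < p} * g \<sigma>)"
      using \<sigma>(2) by (simp add: \<mu>_def insert_absorb)
    \<comment> \<open>Hence the sign built into \<open>\<mu>\<close> equals the sign in the
      coboundary, and their product is 1.\<close>
    also have "{u \<in> \<sigma> - {p}. u < p} = {u \<in> \<sigma>. u < p}" by auto
    finally show ?thesis
      using \<sigma>(1) by (simp add: \<nu>_def flip: mult.assoc power_mult_distrib)
  qed
  have "\<nu> \<sigma> = N S \<sigma>" if S: "S \<in> C" and \<sigma>: "\<sigma> \<in> faces n S" for S \<sigma>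
  proof -
    have SV: "S \<subseteq> V" "p \<in> S" using C[OF S] by auto
    \<comment> \<open>\<open>\<nu>_cone\<close> covers only faces through \<open>p\<close>; the
      others follow because both sides are cocycles on \<open>S\<close>.\<close>
    have "restrict \<nu> (faces n S) \<sigma> = N S \<sigma>"
    proof (rule cocycles_eq_on_cone[OF restrict_cocycle[OF \<nu> SV(1)] N[OF S] SV(2) _ \<sigma>])
      fix \<sigma>' assume "\<sigma>' \<in> faces n S" "p \<in> \<sigma>'"
      then show "restrict \<nu> (faces n S) \<sigma>' = N S \<sigma>'"
        using \<nu>_cone[of \<sigma>'] g[OF S] faces_mono[OF SV(1), of n] by auto
    qed
    then show ?thesis using \<sigma> by simp
  qed
  with \<nu> show ?thesis by (rule that)
qed

section \<open>Colors induced by cocycles\<close>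

lemma color_of_restrict: "T \<subseteq> S \<Longrightarrow> color_of \<omega> T (restrict \<nu> (faces 3 S)) = color_of \<omega> T \<nu>"
  unfolding color_of_def by (simp add: Int_absorb1 faces_mono)

text \<open>The cocycles may live on different simplices, so that neighbouring 5-simplices can be
  compared on a shared 4-face.\<close>

lemma color_of_eq_iff:
  assumes "\<mu> \<in> cocycles 3 S" "\<nu> \<in> cocycles 3 S'" "T \<subseteq> S \<inter> S'"
  shows "color_of \<omega> T \<mu> = color_of \<omega> T \<nu> \<longleftrightarrow> (\<exists>c. \<forall>\<sigma>\<in>faces 3 T. \<mu> \<sigma> - \<nu> \<sigma> = c * \<omega> \<sigma>)"
proof -
  have "restrict \<mu> (faces 3 T) \<in> cocycles 3 T" "restrict \<nu> (faces 3 T) \<in> cocycles 3 T"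
    using assms restrict_cocycle by blast+
  then show ?thesis
    unfolding color_of_def
    by (subst eq_equiv_class_iff[OF equiv_color_rel]) (simp_all add: color_rel_def)
qed

text \<open>The restrictions of a single global cocycle serve as the witnesses on all 5-simplices at
  once.\<close>

lemma permitted_color_of:
  assumes "\<nu> \<in> cocycles 3 V" "C \<subseteq> faces 5 V"
  shows "restrict (\<lambda>T. color_of \<omega> T \<nu>) (\<Union>S\<in>C. faces 4 S) \<in> permitted \<omega> C"
proof -
  let ?y = "restrict (\<lambda>T. color_of \<omega> T \<nu>) (\<Union>S\<in>C. faces 4 S)"
  have sub: "S \<subseteq> V" if "S \<in> C" for S using that assms(2) by (auto simp: faces_def)
  have col: "color_of \<omega> T \<nu> \<in> colors \<omega> T" if "S \<in> C" "T \<in> faces 4 S" for S T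
    using that sub by (intro color_of_in_colors[OF assms(1)]) (auto simp: faces_def)
  have "restrict ?y (faces 4 S) \<in> permitted_simplex \<omega> S" if S: "S \<in> C" for S
  proof -
    have "restrict \<nu> (faces 3 S) \<in> cocycles 3 S" by (rule restrict_cocycle[OF assms(1) sub[OF S]])
    moreover have "restrict ?y (faces 4 S) T = color_of \<omega> T (restrict \<nu> (faces 3 S))"
      if "T \<in> faces 4 S" for T
    proof -
      have "T \<subseteq> S" using that by (simp add: faces_def)
      then show ?thesis using that S by (auto simp: color_of_restrict)
    qed
    moreover have "restrict ?y (faces 4 S) \<in> Pi\<^sub>E (faces 4 S) (colors \<omega>)"
      using S col by auto
    ultimately show ?thesis unfolding permitted_simplex_def by blast
  qed
  then show ?thesis using col by (auto simp: permitted_def)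
qed

section \<open>Intersections of 5-faces of a 6-simplex\<close>

text \<open>The union of two distinct 5-faces is all of \<open>V\<close>, and 6 + 6 - 7 = 5. So any
  two of them share a 4-face, whose color relates their cocycles.\<close>

lemma card_Int_five_faces:
  assumes "card V = 7" "S \<in> faces 5 V" "S' \<in> faces 5 V" "S \<noteq> S'"
  shows "card (S \<inter> S') = 5"
proof -
  have fin: "finite S" "finite S'" "finite V"
    using assms faces_finite by (auto intro: card_ge_0_finite)
  have S: "S \<subseteq> V" "card S = 6" "S' \<subseteq> V" "card S' = 6" using assms by (auto simp: faces_def)
  have "\<not> S' \<subseteq> S" using card_subset_eq[OF fin(1), of S'] S assms(4) by auto
  then have "S \<subset> S \<union> S'" by blast
  then have "card S < card (S \<union> S')" using fin by (intro psubset_card_mono) auto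
  moreover have "card (S \<union> S') \<le> 7" using S fin assms(1) by (metis card_mono le_sup_iff)
  ultimately show ?thesis using card_Un_Int[OF fin(1,2)] S by simp
qed

text \<open>Each 5-face omits one vertex, so three of them, possibly equal, retain at least 7 - 3 =
  4 in common.\<close>

lemma common_tetrahedron:
  assumes "card V = 7" "S1 \<in> faces 5 V" "S2 \<in> faces 5 V" "S3 \<in> faces 5 V"
  obtains \<sigma> where "\<sigma> \<in> faces 3 (S1 \<inter> S2 \<inter> S3)"
proof -
  have fin: "finite V" using assms(1) by (auto intro: card_ge_0_finite)
  have S: "S \<subseteq> V" "card (V - S) = 1" if "S \<in> faces 5 V" for S
    using that assms(1) fin by (auto simp: faces_def card_Diff_subset finite_subset)
  have "card (V - (S1 \<inter> S2 \<inter> S3)) \<le> card (V - S1) + card (V - S2) + card (V - S3)"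
    using card_Un_le[of "V - S1 \<union> (V - S2)" "V - S3"] card_Un_le[of "V - S1" "V - S2"]
    by (simp add: Diff_Int)
  moreover have "card (V - S1) + card (V - S2) + card (V - S3) = 3" using S assms by simp
  moreover have "card (S1 \<inter> S2 \<inter> S3) + card (V - (S1 \<inter> S2 \<inter> S3)) = 7"
    using assms(1) fin S(1)[OF assms(2)]
    by (metis card_Diff_subset card_mono finite_subset inf.coboundedI1 le_add_diff_inverse)
  ultimately have "4 \<le> card (S1 \<inter> S2 \<inter> S3)" by linarith
  then obtain \<sigma> where "\<sigma> \<subseteq> S1 \<inter> S2 \<inter> S3" "card \<sigma> = 4" by (rule obtain_subset_with_card_n)
  then show ?thesis by (intro that[of \<sigma>]) (simp add: faces_def)
qed

section \<open>Gluing local cocycles and comparing the clusters\<close>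

text \<open>Converse to \<open>permitted_color_of\<close> for proper clusters: a 5-face missing from
  \<open>C\<close> supplies the cone apex that the extension requires.\<close>

lemma permitted_from_global_cocycle:
  fixes \<omega> :: "'v::linorder set \<Rightarrow> 'a::field"
  assumes V: "card V = 7"
    and \<omega>: "\<omega> \<in> cocycles 3 V" "\<forall>\<sigma>\<in>faces 3 V. \<omega> \<sigma> \<noteq> 0"
    and C: "C \<subseteq> faces 5 V" "C \<noteq> faces 5 V"
    and x: "x \<in> permitted \<omega> C"
  obtains \<nu> where "\<nu> \<in> cocycles 3 V"
    "\<And>S T. S \<in> C \<Longrightarrow> T \<in> faces 4 S \<Longrightarrow> x T = color_of \<omega> T \<nu>"
proof (cases "C = {}")
  case True
  \<comment> \<open>For the empty cluster any cocycle will do; this one is zero.\<close>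
  have "restrict (\<lambda>\<sigma>. \<omega> \<sigma> - 1 * \<omega> \<sigma>) (faces 3 V) \<in> cocycles 3 V"
    by (rule cocycle_diff_scale[OF \<omega>(1) \<omega>(1)]) simp
  then show ?thesis using True by (intro that) auto
next
  case False
  then obtain S0 where S0: "S0 \<in> C" by blast
  have sub: "S \<subseteq> V" if "S \<in> C" for S using that C by (auto simp: faces_def)
  obtain R where R: "R \<in> faces 5 V" "R \<notin> C" using C by blast
  have finV: "finite V" using V by (auto intro: card_ge_0_finite)
  have "card (V - R) = 1"
    using R(1) V finV by (auto simp: faces_def card_Diff_subset finite_subset)
  then obtain p where p: "V - R = {p}" by (rule card_1_singletonE)
  \<comment> \<open>A 5-face avoiding \<open>p\<close> would lie in \<open>R\<close> and, by
    cardinality, equal it.\<close>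
  have pS: "p \<in> S" if S: "S \<in> C" for S
  proof (rule ccontr)
    assume "p \<notin> S"
    then have "S \<subseteq> R" using p sub[OF S] by auto
    moreover have "card S = card R" using S C(1) R(1) by (auto simp: faces_def)
    ultimately have "S = R" using card_subset_eq faces_finite[OF R(1)] by blast
    then show False using S R(2) by simp
  qed
  have "\<exists>\<nu>. \<nu> \<in> cocycles 3 S \<and> (\<forall>T\<in>faces 4 S. x T = color_of \<omega> T \<nu>)" if "S \<in> C" for S
    using x that by (auto simp: permitted_def permitted_simplex_def)
  then obtain M where M: "\<And>S. S \<in> C \<Longrightarrow> M S \<in> cocycles 3 S"
    and Mx: "\<And>S T. S \<in> C \<Longrightarrow> T \<in> faces 4 S \<Longrightarrow> x T = color_of \<omega> T (M S)"
    by metis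
  \<comment> \<open>Equal pairs are included because \<open>c S S0\<close> is also used for
    \<open>S = S0\<close>.\<close>
  have "\<exists>c. \<forall>\<sigma>\<in>faces 3 (S \<inter> S'). M S \<sigma> - M S' \<sigma> = c * \<omega> \<sigma>" if SS: "S \<in> C" "S' \<in> C" for S S'
  proof (cases "S = S'")
    case True
    then show ?thesis by (auto intro!: exI[of _ 0])
  next
    case False
    then have "card (S \<inter> S') = 5" using card_Int_five_faces[OF V] SS C(1) by blast
    then have "S \<inter> S' \<in> faces 4 S" "S \<inter> S' \<in> faces 4 S'" by (auto simp: faces_def)
    then have "color_of \<omega> (S \<inter> S') (M S) = color_of \<omega> (S \<inter> S') (M S')"
      using Mx SS by metis
    then show ?thesis using color_of_eq_iff[OF M[OF SS(1)] M[OF SS(2)] order.refl] by blast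
  qed
  then obtain c where c: "\<And>S S' \<sigma>. S \<in> C \<Longrightarrow> S' \<in> C \<Longrightarrow> \<sigma> \<in> faces 3 (S \<inter> S') \<Longrightarrow>
      M S \<sigma> - M S' \<sigma> = c S S' * \<omega> \<sigma>"
    by metis
  \<comment> \<open>On a tetrahedron common to \<open>S\<close>, \<open>S'\<close> and
    \<open>S0\<close> the differences of the \<open>M\<close> telescope, and the nonzero
    \<open>\<omega> \<sigma>\<close> cancels.\<close>
  have c_add: "c S S' = c S S0 - c S' S0" if SS: "S \<in> C" "S' \<in> C" for S S'
  proof -
    obtain \<sigma> where \<sigma>: "\<sigma> \<in> faces 3 (S \<inter> S' \<inter> S0)"
      using common_tetrahedron[OF V] SS S0 C(1) by blast
    then have in_faces: "\<sigma> \<in> faces 3 (S \<inter> S')" "\<sigma> \<in> faces 3 (S \<inter> S0)" "\<sigma> \<in> faces 3 (S' \<inter> S0)"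
      by (auto simp: faces_def)
    have "\<omega> \<sigma> \<noteq> 0" using \<omega>(2) \<sigma> sub[OF S0] by (auto simp: faces_def)
    moreover have "c S S' * \<omega> \<sigma> = (c S S0 - c S' S0) * \<omega> \<sigma>"
      unfolding left_diff_distrib c[OF SS in_faces(1), symmetric]
        c[OF SS(1) S0 in_faces(2), symmetric] c[OF SS(2) S0 in_faces(3), symmetric] by simp
    ultimately show ?thesis by simp
  qed
  \<comment> \<open>Normalization against the reference simplex \<open>S0\<close>; it changes
    \<open>M S\<close> only by a multiple of \<open>\<omega>\<close>, hence keeps all
    colors.\<close>
  define N where "N S = restrict (\<lambda>\<sigma>. M S \<sigma> - c S S0 * \<omega> \<sigma>) (faces 3 S)" for S
  have N: "N S \<in> cocycles 3 S" if "S \<in> C" for S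
    unfolding N_def by (rule cocycle_diff_scale[OF M[OF that] \<omega>(1) sub[OF that]])
  have agree: "N S \<sigma> = N S' \<sigma>" if "S \<in> C" "S' \<in> C" "\<sigma> \<in> faces 3 (S \<inter> S')" for S S' \<sigma>
  proof -
    have "M S \<sigma> - M S' \<sigma> = (c S S0 - c S' S0) * \<omega> \<sigma>" using c[OF that] c_add that by simp
    moreover have "\<sigma> \<in> faces 3 S" "\<sigma> \<in> faces 3 S'" using that(3) by (auto simp: faces_def)
    ultimately show ?thesis by (simp add: N_def algebra_simps)
  qed
  obtain \<nu> where \<nu>: "\<nu> \<in> cocycles 3 V" "\<And>S \<sigma>. S \<in> C \<Longrightarrow> \<sigma> \<in> faces 3 S \<Longrightarrow> \<nu> \<sigma> = N S \<sigma>"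
    using cocycle_extension_from_cone[of C V p N 3] sub pS N agree by blast
  have "x T = color_of \<omega> T \<nu>" if ST: "S \<in> C" "T \<in> faces 4 S" for S T
  proof -
    have T: "T \<subseteq> S" using ST by (simp add: faces_def)
    have "M S \<sigma> - \<nu> \<sigma> = c S S0 * \<omega> \<sigma>" if "\<sigma> \<in> faces 3 T" for \<sigma>
      using \<nu>(2)[OF ST(1)] that faces_mono[OF T, of 3] by (auto simp: N_def)
    then have "color_of \<omega> T (M S) = color_of \<omega> T \<nu>"
      using T sub[OF ST(1)] by (subst color_of_eq_iff[OF M[OF ST(1)] \<nu>(1)]) auto
    then show ?thesis using Mx[OF ST] by simp
  qed
  with \<nu>(1) show ?thesis by (rule that)
qed

text \<open>Since \<open>B\<close> is nonempty, \<open>A\<close> is proper and its coloring comes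
  from a global cocycle, which then colors \<open>B\<close> too. The other inclusion follows by
  exchanging the clusters.\<close>

lemma permitted_boundary_subset:
  fixes \<omega> :: "'v::linorder set \<Rightarrow> 'a::field"
  assumes V: "card V = 7"
    and \<omega>: "\<omega> \<in> cocycles 3 V" "\<forall>\<sigma>\<in>faces 3 V. \<omega> \<sigma> \<noteq> 0"
    and AB: "A \<union> B = faces 5 V" "A \<inter> B = {}" "B \<noteq> {}"
  shows "permitted_boundary \<omega> A \<subseteq> permitted_boundary \<omega> B"
proof
  fix z assume "z \<in> permitted_boundary \<omega> A"
  then obtain x where x: "x \<in> permitted \<omega> A" and z: "z = restrict x (boundary A)"
    by (auto simp: permitted_boundary_def)
  have "A \<subseteq> faces 5 V" "A \<noteq> faces 5 V" using AB by blast+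
  then obtain \<nu> where \<nu>: "\<nu> \<in> cocycles 3 V"
    "\<And>S T. S \<in> A \<Longrightarrow> T \<in> faces 4 S \<Longrightarrow> x T = color_of \<omega> T \<nu>"
    using permitted_from_global_cocycle[OF V \<omega> _ _ x] by blast
  let ?y = "restrict (\<lambda>T. color_of \<omega> T \<nu>) (\<Union>S\<in>B. faces 4 S)"
  have eq: "boundary A = boundary B" by (rule common_boundary[OF V AB(1,2)])
  have in_Un: "T \<in> (\<Union>S\<in>D. faces 4 S)" if "T \<in> boundary D" for T :: "'v set" and D
    using that by (auto simp: boundary_def)
  have "z = restrict ?y (boundary B)"
  proof
    fix T
    show "z T = restrict ?y (boundary B) T"
    proof (cases "T \<in> boundary B")
      case True
      \<comment> \<open>A common boundary 4-face also lies in a simplex of \<open>A\<close>, where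
        \<open>x\<close> is known to be induced by \<open>\<nu>\<close>.\<close>
      then obtain S where "S \<in> A" "T \<in> faces 4 S" using in_Un[of T A] eq by blast
      then have "x T = color_of \<omega> T \<nu>" by (rule \<nu>(2))
      then show ?thesis using True in_Un[OF True] by (simp add: z eq)
    qed (simp add: z eq)
  qed
  moreover have "?y \<in> permitted \<omega> B" using AB(1) by (intro permitted_color_of[OF \<nu>(1)]) blast
  ultimately show "z \<in> permitted_boundary \<omega> B" unfolding permitted_boundary_def by blast
qed

theorem proposition2:
  fixes \<omega> :: "nat set \<Rightarrow> 'a::field"
    and C_ini C_fin :: "nat set set"
  assumes "\<omega> \<in> cocycles 3 {1..7}"
    and "\<forall>\<sigma>\<in>faces 3 {1..7}. \<omega> \<sigma> \<noteq> 0"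
    and "C_ini \<union> C_fin = faces 5 {1..7}"
    and "C_ini \<inter> C_fin = {}"
    and "C_ini \<noteq> {}"
    and "C_fin \<noteq> {}"
  shows "permitted_boundary \<omega> C_ini = permitted_boundary \<omega> C_fin"
proof (rule equalityI)
  have V: "card {1..7::nat} = 7" by simp
  show "permitted_boundary \<omega> C_ini \<subseteq> permitted_boundary \<omega> C_fin"
    by (rule permitted_boundary_subset[OF V assms(1-4,6)])
  show "permitted_boundary \<omega> C_fin \<subseteq> permitted_boundary \<omega> C_ini"
    using assms by (intro permitted_boundary_subset[OF V assms(1,2)]) blast+
qed

end
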